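(* The set $(M\setminus L)\cap(3.938,3.939)$ is non-empty. Moreover, the number $$m(\overline{12}331113311321231133311121211333^{*}\overline{11121211333})=3.938776241989784909\ldots$$ belongs to $M\setminus L$.
   Context: For a bi-infinite sequence $\underline{a}=(a_i)_{i\in\mathbb{Z}}\in\{1,2,3,\dots\}^{\mathbb{Z}}$ and $j\in\mathbb{Z}$, let $\lambda_j(\underline{a})=[a_j;a_{j-1},a_{j-2},\dots]+[0;a_{j+1},a_{j+2},\dots]$ (continued fractions), and let $m(\underline{a})=\sup_{j\in\mathbb{Z}}\lambda_j(\underline{a})$ be its Markov value. The Markov spectrum is $M=\{m(\underline{a}):\underline{a}\in\{1,2,3,\dots\}^{\mathbb{Z}}\}$ and the Lagrange spectrum is $L=\{\limsup_{j\to\infty}\lambda_j(\underline{a}):\underline{a}\in\{1,2,3,\dots\}^{\mathbb{Z}}\}$. A sequence is written as a string of digits with an asterisk marking the entry of index $0$; an overline denotes infinite periodic repetition of the overlined block (to the left for a block written at the left end, to the right for a block written at the right end). Thus the sequence above has $a_{-30}\dots a_{0}=331113311321231133311121211333$ (with $a_0=3$), $a_{-31-2k}=2$, $a_{-32-2k}=1$ for $k\ge 0$, and $a_{11k+1}\dots a_{11k+11}=11121211333$ for all $k\geq 0$. *)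

theory Defs
  imports "HOL-Analysis.Analysis"
begin

primrec cf_convergent :: "nat \<Rightarrow> (nat \<Rightarrow> nat) \<Rightarrow> real" where
  "cf_convergent 0 b = real (b 0)"
| "cf_convergent (Suc n) b = real (b 0) + 1 / cf_convergent n (\<lambda>k. b (Suc k))"

definition cfrac :: "(nat \<Rightarrow> nat) \<Rightarrow> real" where
  "cfrac b = lim (\<lambda>n. cf_convergent n b)"

definition bi_seqs :: "(int \<Rightarrow> nat) set" where
  "bi_seqs = {a. \<forall>i. a i \<ge> 1}"

definition lambda_at :: "(int \<Rightarrow> nat) \<Rightarrow> int \<Rightarrow> real" where
  "lambda_at a j =
     cfrac (\<lambda>k. a (j - int k)) + cfrac (\<lambda>k. if k = 0 then 0 else a (j + int k))"

text \<open>
  The supremum and the limit superior are infinite for unbounded sequences, so they are taken in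
  the extended reals. Hence \<open>\<infinity>\<close> belongs to both spectra below, and never to their difference.
\<close>

definition markov_value :: "(int \<Rightarrow> nat) \<Rightarrow> ereal" where
  "markov_value a = (SUP j. ereal (lambda_at a j))"

definition lagrange_value :: "(int \<Rightarrow> nat) \<Rightarrow> ereal" where
  "lagrange_value a = limsup (\<lambda>n. ereal (lambda_at a (int n)))"

definition markov_spectrum :: "ereal set" where
  "markov_spectrum = markov_value ` bi_seqs"

definition lagrange_spectrum :: "ereal set" where
  "lagrange_spectrum = lagrange_value ` bi_seqs"

text \<open>
  The string in which the block \<open>l\<close> is repeated infinitely to the left, followed by the word \<open>c\<close>,
  followed by the block \<open>r\<close> repeated infinitely to the right; the asterisk (index \<open>0\<close>) is on the
  last letter of \<open>c\<close>.
\<close>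

definition bi_string :: "nat list \<Rightarrow> nat list \<Rightarrow> nat list \<Rightarrow> int \<Rightarrow> nat" where
  "bi_string l c r i =
     (if i > 0 then r ! nat ((i - 1) mod int (length r))
      else let p = i + int (length c) - 1
           in if p \<ge> 0 then c ! nat p else l ! nat (p mod int (length l)))"

definition special_seq :: "int \<Rightarrow> nat" where
  "special_seq = bi_string
     [1,2]
     [3,3,1,1,1,3,3,1,1,3,2,1,2,3,1,1,3,3,3,1,1,1,2,1,2,1,1,3,3,3]
     [1,1,1,2,1,2,1,1,3,3,3]"

end

theory Submission
  imports Defs
begin

text \<open>
  Let \<open>\<mu>\<close> be the Markov value in question. The Markov value of the periodic sequence with period
  \<open>33311121211\<close> is \<open>3.938776241981028\<dots>\<close>, slightly below \<open>\<mu>\<close>; put \<open>t = 3.938776241985\<close> and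
  \<open>u = 3.93877624199\<close>, so that it is below \<open>t\<close> and \<open>t < \<mu> < u\<close>. Suppose that
  \<open>t < limsup \<lambda>\<^sub>j(a) < u\<close>. From some index on, all letters are at most 3 and all \<open>\<lambda>\<^sub>j(a)\<close> are below
  \<open>u\<close>. A finite search over words shows that wherever \<open>\<lambda>\<^sub>j(a) > t\<close>, the word
  \<open>w = 33111212113331112121133311\<close> or its reversal surrounds position \<open>j\<close>, and a second search shows
  that every occurrence of \<open>w\<close> forces another one 11 places to its right (hence every occurrence of
  the reversal forces another one to its left). As \<open>\<lambda>\<^sub>j(a) > t\<close> happens for arbitrarily large \<open>j\<close>,
  the periodic pattern spreads over a whole neighbourhood of some such position, where it bounds
  \<open>\<lambda>\<close> by \<open>t\<close>, a contradiction. So the Lagrange spectrum omits the interval from \<open>t\<close> to \<open>u\<close>, which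
  contains \<open>\<mu>\<close>.
\<close>

section \<open>Continued fractions\<close>

lemma cf_convergent_ge_1:
  assumes "\<And>k. b k \<ge> 1"
  shows "cf_convergent n b \<ge> 1"
  using assms
proof (induction n arbitrary: b)
  case (Suc n)
  have "cf_convergent n (\<lambda>k. b (Suc k)) \<ge> 1" using Suc.prems by (rule Suc.IH)
  moreover have "real (b 0) \<ge> 1" using Suc.prems[of 0] by simp
  ultimately show ?case by (simp add: add_increasing2)
qed simp

lemma cf_convergent_bounds:
  assumes "\<And>k. b k \<ge> 1"
  shows "cf_convergent n b \<in> {real (b 0)..real (b 0) + 1}"
proof (cases n)
  case (Suc m)
  have "cf_convergent m (\<lambda>k. b (Suc k)) \<ge> 1" using assms by (intro cf_convergent_ge_1)
  then show ?thesis using Suc by (simp add: field_simps)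
qed simp

text \<open>Two unfoldings apply x -> x / (c x + 1), which turns the difference x - y into (x - y) /
  ((c x + 1) (c y + 1)). Both factors are at least 2, so every two letters gain a factor
  1/4.\<close>

lemma cf_convergent_dist:
  assumes "\<And>k. b k \<ge> 1" "2 * k \<le> m" "2 * k \<le> n"
  shows "\<bar>cf_convergent m b - cf_convergent n b\<bar> \<le> (1/4) ^ k"
  using assms
proof (induction k arbitrary: m n b)
  case 0
  have "cf_convergent m b \<in> {real (b 0)..real (b 0) + 1}"
       "cf_convergent n b \<in> {real (b 0)..real (b 0) + 1}"
    using 0(1) by (intro cf_convergent_bounds; blast)+
  then show ?case by auto
next
  case (Suc k)
  define m' where "m' = m - 2"
  have m: "m = Suc (Suc m')" using Suc.prems(2) by (simp add: m'_def)
  define n' where "n' = n - 2"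
  have n: "n = Suc (Suc n')" using Suc.prems(3) by (simp add: n'_def)
  define x where "x = cf_convergent m' (\<lambda>i. b (Suc (Suc i)))"
  define y where "y = cf_convergent n' (\<lambda>i. b (Suc (Suc i)))"
  have x1: "x \<ge> 1" and y1: "y \<ge> 1"
    unfolding x_def y_def using Suc.prems(1) by (auto intro!: cf_convergent_ge_1)
  have d: "\<bar>x - y\<bar> \<le> (1/4) ^ k"
    unfolding x_def y_def using Suc.prems m n by (intro Suc.IH) auto
  define c where "c = real (b (Suc 0))"
  have c: "c \<ge> 1" using Suc.prems(1)[of "Suc 0"] by (simp add: c_def)
  have cx: "c * x + 1 \<ge> 2" and cy: "c * y + 1 \<ge> 2"
    using mult_mono[of 1 c 1 x] mult_mono[of 1 c 1 y] c x1 y1 by simp_all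
  have "cf_convergent m b - cf_convergent n b = 1 / (c + 1 / x) - 1 / (c + 1 / y)"
    by (simp add: m n x_def y_def c_def)
  also have "1 / (c + 1 / x) = x / (c * x + 1)" using x1 by (simp add: field_simps)
  also have "1 / (c + 1 / y) = y / (c * y + 1)" using y1 by (simp add: field_simps)
  also have "x / (c * x + 1) - y / (c * y + 1) = (x - y) / ((c * x + 1) * (c * y + 1))"
    using cx cy by (simp add: divide_simps) (simp add: algebra_simps)
  finally have "\<bar>cf_convergent m b - cf_convergent n b\<bar> = \<bar>x - y\<bar> / ((c * x + 1) * (c * y + 1))"
    using cx cy by (simp add: abs_mult)
  also have "\<dots> \<le> \<bar>x - y\<bar> / (2 * 2)"
    using cx cy by (intro divide_left_mono mult_mono) auto
  also have "\<dots> \<le> (1/4) ^ Suc k" using d by simp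
  finally show ?case .
qed

lemma cf_convergent_tendsto:
  assumes "\<And>k. b k \<ge> 1"
  shows "(\<lambda>n. cf_convergent n b) \<longlonglongrightarrow> cfrac b"
proof -
  have "Cauchy (\<lambda>n. cf_convergent n b)"
  proof (rule metric_CauchyI)
    fix e :: real assume "e > 0"
    then obtain k where k: "(1/4 :: real) ^ k < e" using real_arch_pow_inv[of e "1/4"] by auto
    have "dist (cf_convergent m b) (cf_convergent n b) < e" if "m \<ge> 2 * k" "n \<ge> 2 * k" for m n
      using cf_convergent_dist[of b k m n, OF assms that] k by (simp add: dist_real_def)
    then show "\<exists>M. \<forall>m\<ge>M. \<forall>n\<ge>M. dist (cf_convergent m b) (cf_convergent n b) < e" by blast
  qed
  then have "convergent (\<lambda>n. cf_convergent n b)" by (rule Cauchy_convergent)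
  then show ?thesis unfolding cfrac_def convergent_LIMSEQ_iff .
qed

lemma cfrac_ge_1:
  assumes "\<And>k. b k \<ge> 1"
  shows "cfrac b \<ge> 1"
  by (rule LIMSEQ_le_const[OF cf_convergent_tendsto[of b, OF assms]])
     (use cf_convergent_ge_1[of b, OF assms] in blast)

text \<open>\<open>b 0\<close> is left free because the right half of \<open>lambda_at\<close> is a
  continued fraction starting with 0.\<close>

lemma cfrac_unfold:
  assumes "\<And>k. b (Suc k) \<ge> 1"
  shows "cfrac b = real (b 0) + 1 / cfrac (\<lambda>k. b (Suc k))"
proof -
  have "(\<lambda>n. real (b 0) + 1 / cf_convergent n (\<lambda>k. b (Suc k)))
      \<longlonglongrightarrow> real (b 0) + 1 / cfrac (\<lambda>k. b (Suc k))"
    using cf_convergent_tendsto[of "\<lambda>k. b (Suc k)", OF assms]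
      cfrac_ge_1[of "\<lambda>k. b (Suc k)", OF assms]
    by (intro tendsto_intros) auto
  then have "(\<lambda>n. cf_convergent (Suc n) b) \<longlonglongrightarrow> real (b 0) + 1 / cfrac (\<lambda>k. b (Suc k))"
    by simp
  then have "(\<lambda>n. cf_convergent n b) \<longlonglongrightarrow> real (b 0) + 1 / cfrac (\<lambda>k. b (Suc k))"
    by (rule LIMSEQ_imp_Suc)
  then show ?thesis unfolding cfrac_def by (rule limI)
qed

text \<open>The value of [0; b 0, b 1, ...]; in these terms both halves of \<open>lambda_at\<close>
  have the same form.\<close>

definition cf_tail :: "(nat \<Rightarrow> nat) \<Rightarrow> real" where
  "cf_tail b = 1 / cfrac b"

lemma cf_tail_unfold:
  assumes "\<And>k. b k \<ge> 1"
  shows "cf_tail b = 1 / (real (b 0) + cf_tail (\<lambda>k. b (Suc k)))"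
  using cfrac_unfold[of b, OF assms] by (simp only: cf_tail_def)

lemma cf_tail_bounds:
  assumes "\<And>k. b k \<ge> 1"
  shows "0 < cf_tail b" "cf_tail b \<le> 1"
  using cfrac_ge_1[of b, OF assms] by (simp_all add: cf_tail_def)

lemma lambda_at_eq:
  assumes "\<And>i. a i \<ge> 1"
  shows "lambda_at a j = real (a j) + cf_tail (\<lambda>k. a (j - 1 - int k)) + cf_tail (\<lambda>k. a (j + 1 + int k))"
proof -
  have "cfrac (\<lambda>k. a (j - int k)) = real (a j) + cf_tail (\<lambda>k. a (j - 1 - int k))"
    using cfrac_unfold[of "\<lambda>k. a (j - int k)"] assms by (simp add: cf_tail_def algebra_simps)
  moreover have "cfrac (\<lambda>k. if k = 0 then 0 else a (j + int k)) = cf_tail (\<lambda>k. a (j + 1 + int k))"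
    using cfrac_unfold[of "\<lambda>k. if k = 0 then 0 else a (j + int k)"] assms
    by (simp add: cf_tail_def algebra_simps)
  ultimately show ?thesis by (simp add: lambda_at_def)
qed

text \<open>Reflection swaps the two halves. This reduces the reversed core word to the core word
  itself.\<close>

lemma lambda_at_reflect:
  assumes "\<And>i. a i \<ge> 1"
  shows "lambda_at (\<lambda>i. a (- i)) j = lambda_at a (- j)"
proof -
  have "- (j - 1 - int k) = - j + 1 + int k" "- (j + 1 + int k) = - j - 1 - int k" for k
    by simp_all
  then show ?thesis
    unfolding lambda_at_eq[of a "- j", OF assms] lambda_at_eq[of "\<lambda>i. a (- i)" j, OF assms]
    by (simp only: ac_simps)
qed

text \<open>Starting from the bound 1, one letter at a time gives 1/(3 + 1) = 1/4, then 1/(1 + 1/4)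
  = 4/5, then 1/(3 + 4/5) = 5/19. Three letters suffice, so a local bound on the letters is
  enough.\<close>

lemma cf_tail_bounds_le_3:
  assumes pos: "\<And>k. b k \<ge> 1" and le3: "\<And>k. k < 3 \<Longrightarrow> b k \<le> 3"
  shows "5 / 19 \<le> cf_tail b" "cf_tail b \<le> 4 / 5"
proof -
  have ge: "1 / (3 + t) \<le> cf_tail c"
    if "\<And>k. c k \<ge> 1" "c 0 \<le> 3" "cf_tail (\<lambda>k. c (Suc k)) \<le> t" for c :: "nat \<Rightarrow> nat" and t
  proof -
    have "0 < cf_tail (\<lambda>k. c (Suc k))" using that(1) by (rule cf_tail_bounds)
    moreover have "real (c 0) \<le> 3" using that(2) by simp
    ultimately show ?thesis
      unfolding cf_tail_unfold[of c, OF that(1)] using that(3) by (intro divide_left_mono) auto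
  qed
  have le: "cf_tail c \<le> 4 / 5" if "\<And>k. c k \<ge> 1" "c 1 \<le> 3" for c :: "nat \<Rightarrow> nat"
  proof -
    have "cf_tail (\<lambda>k. c (Suc (Suc k))) \<le> 1" using that(1) by (rule cf_tail_bounds)
    then have "1 / (3 + 1) \<le> cf_tail (\<lambda>k. c (Suc k))" using that by (intro ge) auto
    moreover have "real (c 0) \<ge> 1" using that(1)[of 0] by simp
    ultimately have "1 / (real (c 0) + cf_tail (\<lambda>k. c (Suc k))) \<le> 1 / (1 + 1 / 4)"
      by (intro divide_left_mono) auto
    then show ?thesis unfolding cf_tail_unfold[of c, OF that(1)] by simp
  qed
  show "cf_tail b \<le> 4 / 5" using pos le3[of 1] by (intro le) auto
  have "cf_tail (\<lambda>k. b (Suc k)) \<le> 4 / 5" using pos le3[of 2] by (intro le) (auto simp: numeral_2_eq_2)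
  then have "1 / (3 + 4 / 5) \<le> cf_tail b" using pos le3[of 0] by (intro ge) auto
  then show "5 / 19 \<le> cf_tail b" by simp
qed

section \<open>Rational bounds from finite words\<close>

text \<open>Numerator and denominator of bounds for \<open>[0; w, \<theta>]\<close>, where \<open>1 / \<theta>\<close> ranges over \<open>[5/19, 4/5]\<close>.\<close>

fun lower_frac upper_frac :: "int list \<Rightarrow> int \<times> int" where
  "lower_frac [] = (5, 19)"
| "lower_frac (x # w) = (case upper_frac w of (p, q) \<Rightarrow> (q, x * q + p))"
| "upper_frac [] = (4, 5)"
| "upper_frac (x # w) = (case lower_frac w of (p, q) \<Rightarrow> (q, x * q + p))"

definition occurs_at :: "(int \<Rightarrow> nat) \<Rightarrow> int list \<Rightarrow> int \<Rightarrow> bool" where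
  "occurs_at a w p \<longleftrightarrow> (\<forall>k < length w. int (a (p + int k)) = w ! k)"

text \<open>The map t -> 1 / (x + t) is decreasing: each letter turns a lower bound into an upper
  one, so both go through the induction together. The three letters beyond \<open>w\<close> provide
  the initial interval [5/19, 4/5].\<close>

lemma frac_bounds:
  fixes b :: "nat \<Rightarrow> nat"
  assumes "\<And>k. b k \<ge> 1" "\<And>k. k < length w + 3 \<Longrightarrow> b k \<le> 3" "\<And>k. k < length w \<Longrightarrow> int (b k) = w ! k"
  shows "0 < fst (lower_frac w) \<and> 0 < snd (lower_frac w)
      \<and> real_of_int (fst (lower_frac w)) / real_of_int (snd (lower_frac w)) \<le> cf_tail b
      \<and> 0 < fst (upper_frac w) \<and> 0 < snd (upper_frac w)
      \<and> cf_tail b \<le> real_of_int (fst (upper_frac w)) / real_of_int (snd (upper_frac w))"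
  using assms
proof (induction w arbitrary: b)
  case Nil
  then show ?case using cf_tail_bounds_le_3[of b] by simp
next
  case (Cons x w)
  let ?c = "\<lambda>k. b (Suc k)"
  obtain p q p' q' where e: "lower_frac w = (p, q)" "upper_frac w = (p', q')" by fastforce
  have IH: "0 < fst (lower_frac w) \<and> 0 < snd (lower_frac w)
      \<and> real_of_int (fst (lower_frac w)) / real_of_int (snd (lower_frac w)) \<le> cf_tail ?c
      \<and> 0 < fst (upper_frac w) \<and> 0 < snd (upper_frac w)
      \<and> cf_tail ?c \<le> real_of_int (fst (upper_frac w)) / real_of_int (snd (upper_frac w))"
    using Cons.prems(1) Cons.prems(2)[of "Suc _"] Cons.prems(3)[of "Suc _"] by (intro Cons.IH) auto
  have x: "int (b 0) = x" using Cons.prems(3)[of 0] by simp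
  then have x': "real (b 0) = real_of_int x" by (metis of_int_of_nat_eq)
  have x1: "real_of_int x \<ge> 1" using Cons.prems(1)[of 0] x' by simp
  have pos: "0 < cf_tail ?c" using Cons.prems(1) by (intro cf_tail_bounds) auto
  have t: "cf_tail b = 1 / (real_of_int x + cf_tail ?c)"
    using cf_tail_unfold[of b, OF Cons.prems(1)] x' by simp
  have r: "p > 0" "q > 0" "p' > 0" "q' > 0" and lo: "real_of_int p / real_of_int q \<le> cf_tail ?c"
    and hi: "cf_tail ?c \<le> real_of_int p' / real_of_int q'"
    using IH e by auto
  have x0: "x > 0" using x1 by simp
  have "cf_tail b \<le> 1 / (real_of_int x + real_of_int p / real_of_int q)"
    unfolding t using lo pos x1 r by (intro divide_left_mono mult_pos_pos add_pos_pos) auto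
  moreover have "1 / (real_of_int x + real_of_int p / real_of_int q) = real_of_int q / real_of_int (x * q + p)"
    using r x1 by (simp add: field_simps)
  moreover have "1 / (real_of_int x + real_of_int p' / real_of_int q') \<le> cf_tail b"
    unfolding t using hi pos x1 r by (intro divide_left_mono mult_pos_pos add_pos_pos) auto
  moreover have "1 / (real_of_int x + real_of_int p' / real_of_int q') = real_of_int q' / real_of_int (x * q' + p')"
    using r x1 by (simp add: field_simps)
  ultimately show ?case using r x0 by (simp add: e add_pos_pos)
qed

text \<open>\<open>lower_test N D w i\<close> and \<open>upper_test N D w i\<close> certify \<open>N / D \<le> \<lambda>\<close> and \<open>\<lambda> \<le> N / D\<close>
  at the \<open>i\<close>-th letter of an occurrence of \<open>w\<close>.\<close>

definition lower_test :: "int \<Rightarrow> int \<Rightarrow> int list \<Rightarrow> nat \<Rightarrow> bool" where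
  "lower_test N D w i \<longleftrightarrow> (case drop i w of [] \<Rightarrow> False | x # v \<Rightarrow>
     (case lower_frac (rev (take i w)) of (p, q) \<Rightarrow> case lower_frac v of (p', q') \<Rightarrow>
       N * (q * q') \<le> D * (x * (q * q') + (p * q' + p' * q))))"

definition upper_test :: "int \<Rightarrow> int \<Rightarrow> int list \<Rightarrow> nat \<Rightarrow> bool" where
  "upper_test N D w i \<longleftrightarrow> (case drop i w of [] \<Rightarrow> False | x # v \<Rightarrow>
     (case upper_frac (rev (take i w)) of (p, q) \<Rightarrow> case upper_frac v of (p', q') \<Rightarrow>
       D * (x * (q * q') + (p * q' + p' * q)) \<le> N * (q * q')))"

text \<open>The left half is read away from the chosen letter, hence reversed. The margin of three
  letters on each side of \<open>w\<close> serves the end bounds of the two halves.\<close>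

lemma occurs_at_tails:
  assumes "\<And>i. a i \<ge> 1" "occurs_at a w p" "drop i w = x # v"
    and le3: "\<And>k. k \<in> {p - 3..p + int (length w) + 2} \<Longrightarrow> a k \<le> 3"
  shows "int (a (p + int i)) = x"
    and "\<And>k. k < length v \<Longrightarrow> int (a (p + int i + 1 + int k)) = v ! k"
    and "\<And>k. k < length (rev (take i w)) \<Longrightarrow> int (a (p + int i - 1 - int k)) = rev (take i w) ! k"
    and "\<And>k. k < length v + 3 \<Longrightarrow> a (p + int i + 1 + int k) \<le> 3"
    and "\<And>k. k < length (rev (take i w)) + 3 \<Longrightarrow> a (p + int i - 1 - int k) \<le> 3"
proof -
  have i: "i < length w" using assms(3) by (metis drop_all list.distinct(1) not_le)
  then have v: "w ! i = x" "v = drop (Suc i) w" 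
    using assms(3) by (metis Cons_nth_drop_Suc list.inject)+
  have occ: "int (a (p + int k)) = w ! k" if "k < length w" for k
    using assms(2) that by (simp add: occurs_at_def)
  show "int (a (p + int i)) = x" using occ[OF i] v by simp
  show "int (a (p + int i + 1 + int k)) = v ! k" if "k < length v" for k
    using occ[of "Suc (i + k)"] that v by (simp add: algebra_simps)
  show "int (a (p + int i - 1 - int k)) = rev (take i w) ! k" if "k < length (rev (take i w))" for k
    using occ[of "i - Suc k"] that i by (simp add: rev_nth algebra_simps of_nat_diff)
  show "a (p + int i + 1 + int k) \<le> 3" if "k < length v + 3" for k
    using that v i by (intro le3) auto
  show "a (p + int i - 1 - int k) \<le> 3" if "k < length (rev (take i w)) + 3" for k
    using that i by (intro le3) auto
qed

lemma
  assumes pos: "\<And>i. a i \<ge> 1" and occ: "occurs_at a w p" and D: "D > 0"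
    and le3: "\<And>k. k \<in> {p - 3..p + int (length w) + 2} \<Longrightarrow> a k \<le> 3"
  shows lower_test_sound: "lower_test N D w i \<Longrightarrow> real_of_int N / real_of_int D \<le> lambda_at a (p + int i)"
    and upper_test_sound: "upper_test N D w i \<Longrightarrow> lambda_at a (p + int i) \<le> real_of_int N / real_of_int D"
proof -
  let ?l = "cf_tail (\<lambda>k. a (p + int i - 1 - int k))" and ?r = "cf_tail (\<lambda>k. a (p + int i + 1 + int k))"
  have lam: "lambda_at a (p + int i) = real_of_int x + ?l + ?r" if "drop i w = x # v" for x v
    using occurs_at_tails(1)[OF pos occ that le3] lambda_at_eq[of a "p + int i", OF pos]
    by (metis of_int_of_nat_eq)
  have eq: "(real_of_int x + real_of_int p1 / real_of_int q1 + real_of_int p2 / real_of_int q2) 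
      = real_of_int (x * (q1 * q2) + (p1 * q2 + p2 * q1)) / real_of_int (q1 * q2)"
    if "q1 > 0" "q2 > 0" for x p1 q1 p2 q2 :: int
    using that by (simp add: field_simps)
  show "real_of_int N / real_of_int D \<le> lambda_at a (p + int i)" if test: "lower_test N D w i"
  proof (cases "drop i w")
    case (Cons x v)
    obtain p1 q1 where e1: "lower_frac (rev (take i w)) = (p1, q1)" by fastforce
    obtain p2 q2 where e2: "lower_frac v = (p2, q2)" by fastforce
    have b1: "q1 > 0" "real_of_int p1 / real_of_int q1 \<le> ?l"
      using frac_bounds[of "\<lambda>k. a (p + int i - 1 - int k)" "rev (take i w)", OF pos
          occurs_at_tails(5)[OF pos occ Cons le3] occurs_at_tails(3)[OF pos occ Cons le3]] e1 by auto
    have b2: "q2 > 0" "real_of_int p2 / real_of_int q2 \<le> ?r"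
      using frac_bounds[of "\<lambda>k. a (p + int i + 1 + int k)" v, OF pos
          occurs_at_tails(4)[OF pos occ Cons le3] occurs_at_tails(2)[OF pos occ Cons le3]] e2 by auto
    have "N * (q1 * q2) \<le> D * (x * (q1 * q2) + (p1 * q2 + p2 * q1))"
      using test by (simp add: lower_test_def Cons e1 e2)
    then have "real_of_int (N * (q1 * q2)) \<le> real_of_int (D * (x * (q1 * q2) + (p1 * q2 + p2 * q1)))"
      by (simp only: of_int_le_iff)
    then have "real_of_int N / real_of_int D \<le> real_of_int (x * (q1 * q2) + (p1 * q2 + p2 * q1)) / real_of_int (q1 * q2)"
      using D b1(1) b2(1) by (simp add: divide_simps mult_ac)
    then show ?thesis using lam[OF Cons] eq[OF b1(1) b2(1), of x p1 p2] b1(2) b2(2) by linarith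
  qed (use test in \<open>simp add: lower_test_def\<close>)
  show "lambda_at a (p + int i) \<le> real_of_int N / real_of_int D" if test: "upper_test N D w i"
  proof (cases "drop i w")
    case (Cons x v)
    obtain p1 q1 where e1: "upper_frac (rev (take i w)) = (p1, q1)" by fastforce
    obtain p2 q2 where e2: "upper_frac v = (p2, q2)" by fastforce
    have b1: "q1 > 0" "?l \<le> real_of_int p1 / real_of_int q1"
      using frac_bounds[of "\<lambda>k. a (p + int i - 1 - int k)" "rev (take i w)", OF pos
          occurs_at_tails(5)[OF pos occ Cons le3] occurs_at_tails(3)[OF pos occ Cons le3]] e1 by auto
    have b2: "q2 > 0" "?r \<le> real_of_int p2 / real_of_int q2"
      using frac_bounds[of "\<lambda>k. a (p + int i + 1 + int k)" v, OF pos
          occurs_at_tails(4)[OF pos occ Cons le3] occurs_at_tails(2)[OF pos occ Cons le3]] e2 by auto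
    have "D * (x * (q1 * q2) + (p1 * q2 + p2 * q1)) \<le> N * (q1 * q2)"
      using test by (simp add: upper_test_def Cons e1 e2)
    then have "real_of_int (D * (x * (q1 * q2) + (p1 * q2 + p2 * q1))) \<le> real_of_int (N * (q1 * q2))"
      by (simp only: of_int_le_iff)
    then have "real_of_int (x * (q1 * q2) + (p1 * q2 + p2 * q1)) / real_of_int (q1 * q2) \<le> real_of_int N / real_of_int D"
      using D b1(1) b2(1) by (simp add: divide_simps mult_ac)
    then show ?thesis using lam[OF Cons] eq[OF b1(1) b2(1), of x p1 p2] b1(2) b2(2) by linarith
  qed (use test in \<open>simp add: upper_test_def\<close>)
qed

section \<open>Certified search\<close>

text \<open>A certificate for a finished search: leaves record why a branch closes, inner nodes on
  which side the next letter 1, 2 or 3 is added. Checking it takes integer arithmetic only.\<close>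

datatype search_tree =
    Done
  | Small
  | Big nat
  | Left search_tree search_tree search_tree
  | Right search_tree search_tree search_tree

text \<open>In \<open>search t T S c w\<close> the word \<open>w\<close> surrounds the position \<open>j\<close> under study, which carries the
  letter of index \<open>c\<close> of \<open>w\<close>. A branch ends when one of the target words \<open>T\<close> has appeared, when
  \<open>\<lambda>\<^sub>j \<le> t\<close> is certain, or when the value at some letter of \<open>w\<close> is certain to be too large.\<close>

primrec search :: "int \<Rightarrow> (nat \<times> int list) list \<Rightarrow> search_tree \<Rightarrow> nat \<Rightarrow> int list \<Rightarrow> bool" where
  "search t T Done c w \<longleftrightarrow>
     list_ex (\<lambda>(d, v). d \<le> c \<and> take (length v) (drop (c - d) w) = v) T"
| "search t T Small c w \<longleftrightarrow> upper_test t (10 ^ 12) w c"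
| "search t T (Big i) c w \<longleftrightarrow> lower_test 3938776241990 (10 ^ 12) w i"
| "search t T (Left x y z) c w \<longleftrightarrow>
     search t T x (Suc c) (1 # w) \<and> search t T y (Suc c) (2 # w) \<and> search t T z (Suc c) (3 # w)"
| "search t T (Right x y z) c w \<longleftrightarrow>
     search t T x c (w @ [1]) \<and> search t T y c (w @ [2]) \<and> search t T z c (w @ [3])"

text \<open>A stretch of the sequence of period \<open>33311121211\<close>; the large value of \<open>\<lambda>\<close> in question is the one at index 12.\<close>

definition core :: "int list" where
  "core = [3,3,1,1,1,2,1,2,1,1,3,3,3,1,1,1,2,1,2,1,1,3,3,3,1,1]"

definition core_tree :: search_tree where
  "core_tree =
    (Right Small Small (Right (Right (Left (Big 1) (Left (Right (Big 2) (Left (Big 3) (Big 3) (Big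
    0)) (Left (Right (Big 6) (Big 3) (Big 3)) Small Small)) (Big 2) (Big 2)) (Right (Right Small
    (Left Small Small (Left (Right (Left (Right Small (Right (Left (Big 5) (Left (Right (Left (Big
    7) (Right (Big 7) (Big 7) (Right (Big 16) (Right (Right (Big 16) (Big 16) (Big 19)) (Big 16)
    (Big 16)) (Left (Left (Left (Left (Big 11) (Big 11) (Right (Big 11) (Big 11) (Left (Big 1)
    (Big 1) (Right (Right Done Small Small) (Big 12) (Big 12))))) (Big 10) (Big 10)) Small Small)
    (Big 8) (Big 8)))) (Big 0)) (Big 6) (Big 14)) (Big 6) (Big 6)) (Right Small (Left (Big 1)
    (Left (Right (Big 7) (Big 7) (Left (Big 3) (Right (Right (Big 8) (Big 17) (Big 17)) (Big 8)
    (Big 8)) (Big 0))) (Big 2) (Big 2)) (Big 6)) (Big 13))) (Left (Big 5) Small Small) (Left (Left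
    (Right (Right (Left (Big 7) (Big 7) Small) (Big 13) (Big 13)) (Left (Big 7) (Big 7) (Left (Big
    1) (Big 1) (Big 8))) (Big 6)) (Big 6) (Big 4)) Small Small)) (Big 10)) (Big 2) (Big 0)) Small
    Small) Small Small)) (Left Small (Right (Big 6) Small Small) (Big 2))) Small Small)) (Big 0)
    (Big 0)) (Left (Right (Left (Left (Big 3) (Right (Big 3) (Big 3) (Big 6)) (Right (Left (Big 1)
    (Big 4) (Big 4)) Small Small)) (Big 2) (Big 0)) (Big 1) (Big 1)) Small Small) (Left (Left
    (Left (Left Small (Right Small Small (Right (Right (Left (Left Small (Right (Right (Left (Big
    7) (Big 7) (Right (Big 7) (Left (Left (Big 9) (Big 2) (Big 0)) (Big 8) (Big 8)) (Left Small
    (Right (Big 15) (Big 15) (Big 8)) (Big 8)))) (Big 6) (Big 8)) (Left (Right (Right (Big 7)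
    (Left (Left (Big 9) (Big 9) (Left (Big 1) (Left (Left (Big 3) (Big 3) (Big 0)) (Big 2) (Big
    2)) (Right (Right (Right (Right (Big 10) (Big 10) (Right (Big 21) (Big 21) (Left (Big 11) (Big
    11) (Left (Left Done Small Small) (Big 12) (Big 12))))) (Big 10) (Big 10)) Small Small) (Big
    10) (Big 10)))) (Big 8) (Big 0)) (Big 14)) (Big 7) (Big 7)) Small Small) (Left (Left Small
    (Right (Big 13) (Right (Right (Big 13) (Left (Big 9) (Big 9) (Left (Left (Big 11) (Big 2) (Big
    0)) (Big 10) (Big 10))) (Big 16)) (Big 13) (Big 13)) (Big 8)) (Big 0)) Small Small)) (Big 0))
    Small Small) (Big 6) (Big 6)) Small Small)) (Right Small (Left (Big 1) Small Small) (Big 4)))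
    Small Small) (Big 2) (Big 0)) Small Small)))"

definition replication_tree :: search_tree where
  "replication_tree =
    (Right (Right (Big 12) (Left (Big 13) (Big 13) (Left (Right (Left (Right (Big 15) (Left (Big
    5) (Left (Left (Big 7) (Left (Right (Right (Right (Big 30) (Big 30) (Right (Big 39) (Right
    (Right (Big 39) (Big 39) (Big 42)) (Big 39) (Big 39)) (Right (Big 30) (Big 30) (Right (Right
    Done (Big 41) (Big 41)) (Big 30) (Big 30))))) (Big 30) (Big 38)) (Big 19) (Big 19)) (Big 8)
    (Big 8)) (Big 0)) (Big 6) (Big 6)) (Right (Right (Right (Big 27) (Big 27) (Right (Big 36)
    (Right (Right (Big 36) (Big 36) (Big 39)) (Big 36) (Big 36)) (Right (Big 27) (Big 27) (Right
    (Right Done (Big 38) (Big 38)) (Big 27) (Big 27))))) (Big 27) (Big 35)) (Big 16) (Big 16)))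
    (Big 32)) (Big 2) (Big 0)) (Big 14) (Big 14)) (Big 14) (Big 14))) (Big 23)) (Big 12) (Big 12))"

text \<open>In a target \<open>(d, v)\<close>, \<open>d\<close> is the distance from the start of
  \<open>v\<close> to the studied position. Index 12 of the 26 letters of \<open>core\<close>
  becomes index 25 - 12 = 13 in the reversal.\<close>

lemma search_core_tree:
  "search 3938776241985 [(12, core), (13, rev core)] core_tree 0 []"
  by code_simp

text \<open>The target prolongs \<open>core\<close> by one period of 11 letters. Threshold 0 makes
  the alternative of a small value impossible, so only large values close the other
  branches.\<close>

lemma search_replication_tree:
  "search 0 [(12, core @ [1,2,1,2,1,1,3,3,3,1,1])] replication_tree 12 core"
  by code_simp

section \<open>Occurrences of words under concatenation, infixes and reversal\<close>

lemma occurs_at_Cons: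
  "occurs_at a (x # w) p \<longleftrightarrow> int (a p) = x \<and> occurs_at a w (p + 1)"
  by (auto simp: occurs_at_def nth_Cons' less_Suc_eq_0_disj algebra_simps)

lemma occurs_at_append:
  "occurs_at a (u @ v) p \<longleftrightarrow> occurs_at a u p \<and> occurs_at a v (p + int (length u))"
proof (induction u arbitrary: p)
  case Nil
  show ?case by (simp add: occurs_at_def[of _ "[]"])
next
  case (Cons x u)
  then show ?case by (simp add: occurs_at_Cons add.assoc)
qed

lemma occurs_at_infix:
  assumes "occurs_at a w p" "take (length v) (drop k w) = v"
  shows "occurs_at a v (p + int k)"
proof (cases "k \<le> length w")
  case True
  have "w = take k w @ v @ drop (length v) (drop k w)"
    using assms(2) by (metis append_take_drop_id)
  then show ?thesis
    using assms(1) True by (metis occurs_at_append length_take min.absorb2)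
\<comment> \<open>Beyond the end of \<open>w\<close> the infix condition forces \<open>v\<close> to
  be empty.\<close>
qed (use assms(2) in \<open>auto simp: occurs_at_def\<close>)

lemma occurs_at_drop:
  assumes "occurs_at a w p" "k \<le> length w"
  shows "occurs_at a (drop k w) (p + int k)"
  using assms by (intro occurs_at_infix) auto

lemma occurs_at_reflect:
  assumes "occurs_at a (rev w) p"
  shows "occurs_at (\<lambda>i. a (- i)) w (- p - int (length w) + 1)"
  unfolding occurs_at_def
proof (intro allI impI)
  fix k assume "k < length w"
  then show "int (a (- (- p - int (length w) + 1 + int k))) = w ! k"
    using assms[unfolded occurs_at_def, rule_format, of "length w - Suc k"]
    by (simp add: rev_nth of_nat_diff algebra_simps)
qed

lemma occurs_at_map_upto:
  "occurs_at a (map (\<lambda>i. int (a i)) [m..n]) m"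
  by (auto simp: occurs_at_def)

text \<open>Stated at a single index, since a limit superior below u controls only the indices from
  some point on.\<close>

definition admissible :: "(int \<Rightarrow> nat) \<Rightarrow> int \<Rightarrow> bool" where
  "admissible a i \<longleftrightarrow> a i \<le> 3 \<and> lambda_at a i < 3938776241990 / 10 ^ 12"

text \<open>The last premise keeps all letters read within distance \<open>N\<close> of
  \<open>j\<close>: an extension raises \<open>length w + c\<close> by at most 2 while the tree
  shrinks, and 3 is the margin of the end bounds.\<close>

lemma search_sound:
  assumes pos: "\<And>i. a i \<ge> 1" and adm: "\<And>i. \<bar>i - j\<bar> \<le> N \<Longrightarrow> admissible a i"
    and "search t T S c w" "occurs_at a w (j - int c)"
    and "int (length w + c + 2 * size S + 3) \<le> N"
  shows "lambda_at a j \<le> real_of_int t / 10 ^ 12 \<or> (\<exists>(d, v) \<in> set T. occurs_at a v (j - int d))"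
  using assms(3-)
proof (induction S arbitrary: c w)
  case Done
  then obtain d v where dv: "(d, v) \<in> set T" "d \<le> c" "take (length v) (drop (c - d) w) = v"
    by (auto simp: list_ex_iff)
  have "occurs_at a v (j - int c + int (c - d))"
    using Done.prems(2) dv(3) by (rule occurs_at_infix)
  then show ?case using dv by (auto simp: of_nat_diff)
next
  case Small
  have "lambda_at a (j - int c + int c) \<le> real_of_int t / real_of_int (10 ^ 12)"
    using Small.prems by (intro upper_test_sound[OF pos Small.prems(2)])
      (use adm in \<open>auto simp: admissible_def\<close>)
  then show ?case by simp
next
  case (Big i)
  have "real_of_int 3938776241990 / real_of_int (10 ^ 12) \<le> lambda_at a (j - int c + int i)"
    using Big.prems by (intro lower_test_sound[OF pos Big.prems(2)])
      (use adm in \<open>auto simp: admissible_def\<close>)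
  \<comment> \<open>\<open>lower_test\<close> fails past the end of the word, so the offending index
    lies in the window.\<close>
  moreover have "i < length w"
    using Big.prems(1) by (cases "drop i w") (auto simp: lower_test_def, metis drop_all list.distinct(1) not_le)
  then have "admissible a (j - int c + int i)" using Big.prems(3) by (intro adm) auto
  ultimately show ?case by (simp add: admissible_def)
next
  case (Left x y z)
  have "admissible a (j - int c - 1)" using Left.prems(3) by (intro adm) auto
  then have "a (j - int c - 1) \<in> {1, 2, 3}"
    using pos[of "j - int c - 1"] by (auto simp: admissible_def)
  then have "occurs_at a (1 # w) (j - int (Suc c)) \<or> occurs_at a (2 # w) (j - int (Suc c))
      \<or> occurs_at a (3 # w) (j - int (Suc c))"
    using Left.prems(2) by (auto simp: occurs_at_Cons algebra_simps)
  then show ?case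
  proof (elim disjE)
    assume "occurs_at a (1 # w) (j - int (Suc c))"
    from Left.IH(1)[OF _ this] show ?thesis using Left.prems by simp
  next
    assume "occurs_at a (2 # w) (j - int (Suc c))"
    from Left.IH(2)[OF _ this] show ?thesis using Left.prems by simp
  next
    assume "occurs_at a (3 # w) (j - int (Suc c))"
    from Left.IH(3)[OF _ this] show ?thesis using Left.prems by simp
  qed
next
  case (Right x y z)
  let ?k = "j - int c + int (length w)"
  have "admissible a ?k" using Right.prems(3) by (intro adm) auto
  then have "a ?k \<in> {1, 2, 3}" using pos[of ?k] by (auto simp: admissible_def)
  then have "occurs_at a (w @ [1]) (j - int c) \<or> occurs_at a (w @ [2]) (j - int c)
      \<or> occurs_at a (w @ [3]) (j - int c)"
    using Right.prems(2) by (auto simp: occurs_at_append occurs_at_def[of _ "[_]"])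
  then show ?case
  proof (elim disjE)
    assume "occurs_at a (w @ [1]) (j - int c)"
    from Right.IH(1)[OF _ this] show ?thesis using Right.prems by simp
  next
    assume "occurs_at a (w @ [2]) (j - int c)"
    from Right.IH(2)[OF _ this] show ?thesis using Right.prems by simp
  next
    assume "occurs_at a (w @ [3]) (j - int c)"
    from Right.IH(3)[OF _ this] show ?thesis using Right.prems by simp
  qed
qed

section \<open>Forcing and spreading of the core word\<close>

lemma length_core: "length core = 26"
  by (simp add: core_def)

text \<open>The radius depends on the tree alone, so it can be fixed before \<open>j\<close> is
  chosen.\<close>

lemma core_forced:
  "\<exists>N. \<forall>a j. (\<forall>i. a i \<ge> 1) \<longrightarrow> (\<forall>i. \<bar>i - j\<bar> \<le> N \<longrightarrow> admissible a i)
    \<longrightarrow> lambda_at a j > 3938776241985 / 10 ^ 12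
    \<longrightarrow> occurs_at a core (j - 12) \<or> occurs_at (\<lambda>i. a (- i)) core (- j - 12)"
proof (intro exI allI impI)
  fix a j
  assume "\<forall>i. a i \<ge> 1" and "\<forall>i. \<bar>i - j\<bar> \<le> int (2 * size core_tree + 3) \<longrightarrow> admissible a i"
    and gt: "lambda_at a j > 3938776241985 / 10 ^ 12"
  then have pos: "\<And>i. a i \<ge> 1"
    and adm: "\<And>i. \<bar>i - j\<bar> \<le> int (2 * size core_tree + 3) \<Longrightarrow> admissible a i" by auto
  have "occurs_at a [] (j - int 0)" by (simp add: occurs_at_def)
  from search_sound[OF pos adm search_core_tree this] gt
  have "occurs_at a core (j - 12) \<or> occurs_at a (rev core) (j - 13)" by auto
  \<comment> \<open>Reflecting the reversal at \<open>j - 13\<close> puts \<open>core\<close> at -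
    (j - 13) - 26 + 1 = - j - 12.\<close>
  then show "occurs_at a core (j - 12) \<or> occurs_at (\<lambda>i. a (- i)) core (- j - 12)"
    using occurs_at_reflect[of a core "j - 13"] by (auto simp: length_core algebra_simps)
qed

lemma core_replicates:
  "\<exists>N \<ge> 0. \<forall>a p. (\<forall>i. a i \<ge> 1) \<longrightarrow> (\<forall>i. \<bar>i - (p + 12)\<bar> \<le> N \<longrightarrow> admissible a i)
    \<longrightarrow> occurs_at a core p \<longrightarrow> occurs_at a core (p + 11)"
proof (intro exI conjI allI impI)
  let ?N = "int (length core + 12 + 2 * size replication_tree + 3)"
  show "?N \<ge> 0" by simp
  fix a p
  assume "\<forall>i. a i \<ge> 1" and "\<forall>i. \<bar>i - (p + 12)\<bar> \<le> ?N \<longrightarrow> admissible a i"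
    and occ: "occurs_at a core p"
  then have pos: "\<And>i. a i \<ge> 1" and adm: "\<And>i. \<bar>i - (p + 12)\<bar> \<le> ?N \<Longrightarrow> admissible a i" by auto
  \<comment> \<open>This excludes the alternative left open by the threshold 0.\<close>
  have "lambda_at a (p + 12) > 0"
    unfolding lambda_at_eq[of a, OF pos] using cf_tail_bounds(1)[of "\<lambda>k. a (p + 12 - 1 - int k)", OF pos]
      cf_tail_bounds(1)[of "\<lambda>k. a (p + 12 + 1 + int k)", OF pos] by linarith
  moreover have "occurs_at a core (p + 12 - int 12)" using occ by simp
  from search_sound[OF pos adm search_replication_tree this]
  have "lambda_at a (p + 12) \<le> 0 \<or> occurs_at a (core @ [1,2,1,2,1,1,3,3,3,1,1]) p" by simp
  ultimately have "occurs_at a (core @ [1,2,1,2,1,1,3,3,3,1,1]) p" by simp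
  then have "occurs_at a (drop 11 (core @ [1,2,1,2,1,1,3,3,3,1,1])) (p + int 11)"
    by (rule occurs_at_drop) simp
  moreover have "drop 11 (core @ [1,2,1,2,1,1,3,3,3,1,1]) = core" by (simp add: core_def)
  ultimately show "occurs_at a core (p + 11)" by simp
qed

text \<open>Three copies of \<open>core\<close>, each shifted by 11, overlap to a word of 48
  letters. The indices 18 to 28 form one full period with at least 18 known letters on either side,
  enough for the bound t.\<close>

lemma upper_test_periodic:
  "list_all (upper_test 3938776241985 (10 ^ 12) (core @ drop 15 core @ drop 15 core)) [18..<29]"
  by code_simp

lemma lambda_at_periodic_le:
  assumes pos: "\<And>i. a i \<ge> 1" and le3: "\<And>i. i \<in> {p - 3..p + 50} \<Longrightarrow> a i \<le> 3"
    and occ: "occurs_at a core p" "occurs_at a core (p + 11)" "occurs_at a core (p + 22)"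
    and i: "i \<in> {p + 18..p + 28}"
  shows "lambda_at a i \<le> 3938776241985 / 10 ^ 12"
proof -
  \<comment> \<open>The last 11 letters of each shifted copy begin exactly where the preceding copy
    ends.\<close>
  have "occurs_at a (drop 15 core) (p + 26)" "occurs_at a (drop 15 core) (p + 37)"
    using occurs_at_drop[OF occ(2), of 15] occurs_at_drop[OF occ(3), of 15] by (simp_all add: length_core add.commute)
  then have occ': "occurs_at a (core @ drop 15 core @ drop 15 core) p"
    using occ(1) by (simp add: occurs_at_append length_core add.commute)
  define k where "k = nat (i - p)"
  have k: "k \<in> {18..<29}" "i = p + int k" using i by (auto simp: k_def)
  have "upper_test 3938776241985 (10 ^ 12) (core @ drop 15 core @ drop 15 core) k"
    using upper_test_periodic k(1) by (simp only: list_all_iff set_upt)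
  then have "lambda_at a (p + int k) \<le> real_of_int 3938776241985 / real_of_int (10 ^ 12)"
    by (intro upper_test_sound[OF pos occ']) (use le3 in \<open>auto simp: length_core\<close>)
  then show ?thesis using k(2) by simp
qed

text \<open>Replication is iterated from \<open>p\<close> until three consecutive copies surround
  \<open>i\<close>. The margin is uniform in \<open>a\<close>, so it also serves the reflected
  sequence.\<close>

lemma core_propagates:
  "\<exists>N \<ge> 0. \<forall>a p i. (\<forall>l. a l \<ge> 1) \<longrightarrow> (\<forall>l. p - N \<le> l \<and> l \<le> i + N \<longrightarrow> admissible a l)
    \<longrightarrow> occurs_at a core p \<longrightarrow> p + 18 \<le> i \<longrightarrow> lambda_at a i \<le> 3938776241985 / 10 ^ 12"
proof -
  obtain N where N: "N \<ge> 0" and rep: "\<And>a p. \<lbrakk>\<forall>i. a i \<ge> 1;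
      \<forall>i. \<bar>i - (p + 12)\<bar> \<le> N \<longrightarrow> admissible a i; occurs_at a core p\<rbrakk> \<Longrightarrow> occurs_at a core (p + 11)"
    using core_replicates by blast
  show ?thesis
  proof (intro exI conjI allI impI)
    show "N + 100 \<ge> 0" using N by simp
    fix a p i
    assume "\<forall>l. a l \<ge> 1" and "\<forall>l. p - (N + 100) \<le> l \<and> l \<le> i + (N + 100) \<longrightarrow> admissible a l"
      and occ: "occurs_at a core p" and i: "p + 18 \<le> i"
    then have pos: "\<And>l. a l \<ge> 1"
      and adm: "\<And>l. \<lbrakk>p - (N + 100) \<le> l; l \<le> i + (N + 100)\<rbrakk> \<Longrightarrow> admissible a l" by auto
    \<comment> \<open>The slack 20 leaves room for the two copies after the one at
      \<open>?q\<close>, the last of which starts at \<open>?q + 22\<close>, at most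
      \<open>i + 4\<close>.\<close>
    have occs: "p + 11 * int k \<le> i + 20 \<Longrightarrow> occurs_at a core (p + 11 * int k)" for k
    proof (induction k)
      case (Suc k)
      have "occurs_at a core (p + 11 * int k + 11)"
        using Suc by (intro rep allI impI pos adm Suc.IH) auto
      then show ?case by (simp add: algebra_simps)
    qed (use occ in simp)
    define k where "k = nat ((i - p - 18) div 11)"
    have k: "int k = (i - p - 18) div 11" using i by (simp add: k_def pos_imp_zdiv_nonneg_iff)
    let ?q = "p + 11 * int k"
    have q: "?q + 18 \<le> i" "i \<le> ?q + 28" unfolding k by presburger+
    have "occurs_at a core (?q + 11)" "occurs_at a core (?q + 22)"
      using occs[of "k + 1"] occs[of "k + 2"] q by (simp_all add: algebra_simps)
    moreover have "occurs_at a core ?q" using occs[of k] q by simp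
    moreover have "a l \<le> 3" if "l \<in> {?q - 3..?q + 50}" for l
      using adm[of l] that q N by (auto simp: admissible_def)
    ultimately show "lambda_at a i \<le> 3938776241985 / 10 ^ 12"
      using q by (intro lambda_at_periodic_le[of a ?q i, OF pos]) auto
  qed
qed

section \<open>The gap in the Lagrange spectrum\<close>

lemma admissible_reflect:
  assumes "\<And>i. a i \<ge> 1"
  shows "admissible (\<lambda>i. a (- i)) i \<longleftrightarrow> admissible a (- i)"
  by (simp add: admissible_def lambda_at_reflect[of a, OF assms])

text \<open>Three large positions i < j < k are compared. The middle one forces \<open>core\<close>
  or its reversal; the pattern then spreads right to k or left to i and makes the value there
  small.\<close>

lemma not_frequently_large:
  assumes pos: "\<And>i. a i \<ge> 1" and adm: "\<And>i. i \<ge> M \<Longrightarrow> admissible a i"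
  shows "\<exists>K. \<forall>j \<ge> K. lambda_at a j \<le> 3938776241985 / 10 ^ 12"
proof (rule ccontr)
  assume "\<not> ?thesis"
  then have large: "\<exists>j \<ge> K. lambda_at a j > 3938776241985 / 10 ^ 12" for K by (meson not_le)
  obtain N1 where forced: "\<And>a j. \<lbrakk>\<forall>i. a i \<ge> 1; \<forall>i. \<bar>i - j\<bar> \<le> N1 \<longrightarrow> admissible a i;
      lambda_at a j > 3938776241985 / 10 ^ 12\<rbrakk>
    \<Longrightarrow> occurs_at a core (j - 12) \<or> occurs_at (\<lambda>i. a (- i)) core (- j - 12)"
    using core_forced by blast
  obtain N2 where N2: "N2 \<ge> 0" and propagates: "\<And>a p i. \<lbrakk>\<forall>l. a l \<ge> 1;
      \<forall>l. p - N2 \<le> l \<and> l \<le> i + N2 \<longrightarrow> admissible a l; occurs_at a core p; p + 18 \<le> i\<rbrakk>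
    \<Longrightarrow> lambda_at a i \<le> 3938776241985 / 10 ^ 12"
    using core_propagates by blast
  let ?r = "\<lambda>i. a (- i)"
  \<comment> \<open>Spreading left from \<open>j\<close> stops at \<open>i\<close>, so all letters
    consulted stay at indices at least \<open>M\<close>. The absolute value covers an
    \<open>N1\<close> of unknown sign; 12 is the offset of \<open>core\<close>.\<close>
  define K where "K = M + \<bar>N1\<bar> + N2 + 12"
  obtain i where i: "i \<ge> K" "lambda_at a i > 3938776241985 / 10 ^ 12" using large by blast
  obtain j where j: "j \<ge> i + 6" "lambda_at a j > 3938776241985 / 10 ^ 12" using large by blast
  obtain k where k: "k \<ge> j + 6" "lambda_at a k > 3938776241985 / 10 ^ 12" using large by blast
  have "\<forall>l. \<bar>l - j\<bar> \<le> N1 \<longrightarrow> admissible a l"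
    using i(1) j(1) N2 by (auto intro!: adm simp: K_def)
  from forced[OF _ this j(2)] pos
  have "occurs_at a core (j - 12) \<or> occurs_at ?r core (- j - 12)" by blast
  then show False
  proof
    assume occ: "occurs_at a core (j - 12)"
    have "lambda_at a k \<le> 3938776241985 / 10 ^ 12"
      by (rule propagates[OF _ _ occ]) (use pos i(1) j(1) k(1) in \<open>auto intro!: adm simp: K_def\<close>)
    then show False using k(2) by simp
  next
    assume occ: "occurs_at ?r core (- j - 12)"
    have "lambda_at ?r (- i) \<le> 3938776241985 / 10 ^ 12"
      by (rule propagates[OF _ _ occ]) (use pos i(1) j(1) N2 in
        \<open>auto simp: K_def admissible_reflect[of a, OF pos] intro!: adm\<close>)
    then show False using i(2) lambda_at_reflect[of a "- i", OF pos] by simp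
  qed
qed

lemma lagrange_value_gap:
  assumes pos: "\<And>i. a i \<ge> 1"
  shows "lagrange_value a \<notin> {ereal (3938776241985 / 10 ^ 12)<..<ereal (3938776241990 / 10 ^ 12)}"
proof
  assume "lagrange_value a \<in> {ereal (3938776241985 / 10 ^ 12)<..<ereal (3938776241990 / 10 ^ 12)}"
  then have gt: "ereal (3938776241985 / 10 ^ 12) < lagrange_value a"
    and lt: "lagrange_value a < ereal (3938776241990 / 10 ^ 12)" by auto
  have "\<forall>\<^sub>F n in sequentially. ereal (lambda_at a (int n)) < ereal (3938776241990 / 10 ^ 12)"
    using lt unfolding lagrange_value_def by (rule Limsup_lessD)
  then obtain n0 where n0: "\<And>n. n \<ge> n0 \<Longrightarrow> lambda_at a (int n) < 3938776241990 / 10 ^ 12"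
    by (auto simp: eventually_sequentially)
  have "admissible a i" if "i \<ge> int n0" for i
  proof -
    have l: "lambda_at a i < 3938776241990 / 10 ^ 12"
      using n0[of "nat i"] that by simp
    \<comment> \<open>Both tails are positive, so a value below 4 leaves only the letters 1, 2 and
      3.\<close>
    have "real (a i) < lambda_at a i"
      unfolding lambda_at_eq[of a, OF pos] using cf_tail_bounds(1)[of "\<lambda>k. a (i - 1 - int k)", OF pos]
        cf_tail_bounds(1)[of "\<lambda>k. a (i + 1 + int k)", OF pos] by linarith
    then have "real (a i) < 4" using l by simp
    then show ?thesis using l by (simp add: admissible_def)
  qed
  from not_frequently_large[OF pos this] obtain K
    where K: "\<And>j. j \<ge> K \<Longrightarrow> lambda_at a j \<le> 3938776241985 / 10 ^ 12" by blast
  have "\<forall>\<^sub>F n in sequentially. ereal (lambda_at a (int n)) \<le> ereal (3938776241985 / 10 ^ 12)"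
    unfolding eventually_sequentially ereal_less_eq(3) by (intro exI[of _ "nat K"] allI impI K) simp
  then have "lagrange_value a \<le> ereal (3938776241985 / 10 ^ 12)"
    unfolding lagrange_value_def by (rule Limsup_bounded)
  with gt show False by simp
qed

section \<open>The Markov value of the special sequence\<close>

lemma nth_mod_length_in_set: "xs \<noteq> [] \<Longrightarrow> xs ! nat (n mod int (length xs)) \<in> set xs"
  by (intro nth_mem) (simp add: nat_less_iff)

lemma bi_string_in_set:
  assumes "l \<noteq> []" "r \<noteq> []"
  shows "bi_string l c r i \<in> set l \<union> set c \<union> set r"
proof -
  have "c ! nat p \<in> set c" if "0 \<le> p" "p < int (length c)" for p
    using that by (intro nth_mem) (simp add: nat_less_iff)
  then show ?thesis
    using nth_mod_length_in_set[OF assms(1)] nth_mod_length_in_set[OF assms(2)]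
    by (simp add: bi_string_def Let_def)
qed

lemma bi_string_left_in_set:
  assumes "l \<noteq> []" "i \<le> - int (length c)"
  shows "bi_string l c r i \<in> set l"
  using assms nth_mod_length_in_set[OF assms(1)] by (simp add: bi_string_def Let_def)

lemma bi_string_period:
  assumes "i > 0"
  shows "bi_string l c r (i + int (length r)) = bi_string l c r i"
proof -
  have "(i + int (length r) - 1) mod int (length r) = (i - 1) mod int (length r)"
    by (metis add_diff_eq diff_add_eq mod_add_self2)
  then show ?thesis using assms by (simp add: bi_string_def)
qed

lemma special_seq_bounds: "special_seq i \<in> {1..3}"
  using bi_string_in_set[of "[1,2]" "[1,1,1,2,1,2,1,1,3,3,3]"
      "[3,3,1,1,1,3,3,1,1,3,2,1,2,3,1,1,3,3,3,1,1,1,2,1,2,1,1,3,3,3]" i]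
  unfolding special_seq_def by auto

text \<open>The middle word has 30 letters, at the indices -29 to 0.\<close>

lemma special_seq_left: "i \<le> -30 \<Longrightarrow> special_seq i \<le> 2"
  using bi_string_left_in_set[of "[1,2]" i
      "[3,3,1,1,1,3,3,1,1,3,2,1,2,3,1,1,3,3,3,1,1,1,2,1,2,1,1,3,3,3]"
      "[1,1,1,2,1,2,1,1,3,3,3]"]
  unfolding special_seq_def by auto

lemma special_seq_period: "i > 0 \<Longrightarrow> special_seq (i + 11) = special_seq i"
  using bi_string_period[of i _ _ "[1,1,1,2,1,2,1,1,3,3,3]"] by (simp add: special_seq_def)

text \<open>The first right-hand block ends with 33 at the indices 10 and 11, where
  \<open>core\<close> can start; periodicity gives the later copies.\<close>

lemma core_occurs_special_seq: "occurs_at special_seq core (10 + 11 * int m)"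
proof (induction m)
  case 0
  have "map (\<lambda>i. int (special_seq i)) [10..35] = core" by code_simp
  then show ?case using occurs_at_map_upto[of special_seq 10 35] by simp
next
  case (Suc m)
  have "special_seq (10 + 11 * int (Suc m) + int k) = special_seq (10 + 11 * int m + int k)" for k
    using special_seq_period[of "10 + 11 * int m + int k"] by (simp add: algebra_simps)
  then show ?case using Suc by (simp only: occurs_at_def)
qed

abbreviation special_window :: "int list" where
  "special_window \<equiv> map (\<lambda>i. int (special_seq i)) [-42..55]"

lemma lower_test_special:
  "lower_test 3938776241989784909 (10 ^ 18) special_window 42"
  by code_simp

text \<open>Window index k stands for position k - 42, so these are the positions -29 to 27. The
  extra digit keeps the bound strict after passing to the supremum.\<close>

lemma upper_test_special:
  "list_all (upper_test 39387762419897849099 (10 ^ 19) special_window) [13..<70]"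
  by code_simp

lemma special_seq_pos: "special_seq i \<ge> 1"
  using special_seq_bounds[of i] by simp

lemma lambda_at_special_lower: "3938776241989784909 / 10 ^ 18 \<le> lambda_at special_seq 0"
proof -
  have "real_of_int 3938776241989784909 / real_of_int (10 ^ 18) \<le> lambda_at special_seq (- 42 + int 42)"
    by (rule lower_test_sound[OF special_seq_pos occurs_at_map_upto _ _ lower_test_special])
      (use special_seq_bounds in auto)
  then show ?thesis by simp
qed

lemma lambda_at_special_upper: "lambda_at special_seq j \<le> 39387762419897849099 / 10 ^ 19"
proof -
  have le3: "special_seq i \<le> 3" for i using special_seq_bounds[of i] by simp
  \<comment> \<open>The bound 28 = 10 + 18 is where the periodic estimate starts, with
    \<open>core\<close> at index 10.\<close>
  consider "j \<le> -30" | "-30 < j" "j < 28" | "j \<ge> 28" by linarith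
  then show ?thesis
  proof cases
    case 1
    \<comment> \<open>With letter at most 2, the value is at most 2 + 4/5 + 4/5 = 3.6.\<close>
    have "cf_tail (\<lambda>k. special_seq (j - 1 - int k)) \<le> 4 / 5" "cf_tail (\<lambda>k. special_seq (j + 1 + int k)) \<le> 4 / 5"
      by (intro cf_tail_bounds_le_3 special_seq_pos le3)+
    moreover have "real (special_seq j) \<le> 2" using special_seq_left[OF 1] by simp
    ultimately show ?thesis using lambda_at_eq[of special_seq j, OF special_seq_pos] by simp
  next
    case 2
    define k where "k = nat (j + 42)"
    have k: "k \<in> {13..<70}" "j = -42 + int k" using 2 by (auto simp: k_def)
    have test: "upper_test 39387762419897849099 (10 ^ 19) special_window k"
      using upper_test_special k(1) by (simp only: list_all_iff set_upt)
    have "lambda_at special_seq (-42 + int k) \<le> real_of_int 39387762419897849099 / real_of_int (10 ^ 19)"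
      by (rule upper_test_sound[OF special_seq_pos occurs_at_map_upto _ le3 test]) simp
    then show ?thesis using k(2) by simp
  next
    case 3
    define m where "m = nat ((j - 28) div 11)"
    have m: "int m = (j - 28) div 11" using 3 by (simp add: m_def pos_imp_zdiv_nonneg_iff)
    let ?p = "10 + 11 * int m"
    have p: "?p + 18 \<le> j" "j \<le> ?p + 28" unfolding m by presburger+
    have "occurs_at special_seq core (?p + 11)" "occurs_at special_seq core (?p + 22)"
      using core_occurs_special_seq[of "m + 1"] core_occurs_special_seq[of "m + 2"]
      by (simp_all add: algebra_simps)
    then have "lambda_at special_seq j \<le> 3938776241985 / 10 ^ 12"
      by (intro lambda_at_periodic_le[OF special_seq_pos le3 core_occurs_special_seq]) (use p in simp_all)
    then show ?thesis by simp
  qed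
qed

theorem theorem1p1:
  shows "(markov_spectrum - lagrange_spectrum) \<inter> {ereal 3.938<..<ereal 3.939} \<noteq> {}
    \<and> markov_value special_seq \<in> markov_spectrum - lagrange_spectrum
    \<and> ereal 3.938776241989784909 \<le> markov_value special_seq
    \<and> markov_value special_seq < ereal 3.938776241989784910"
proof -
  let ?m = "markov_value special_seq"
  have "ereal 3.938776241989784909 \<le> ereal (lambda_at special_seq 0)"
    using lambda_at_special_lower by simp
  also have "\<dots> \<le> ?m" unfolding markov_value_def by (rule SUP_upper) simp
  finally have lower: "ereal 3.938776241989784909 \<le> ?m" .
  have "?m \<le> ereal (39387762419897849099 / 10 ^ 19)"
    unfolding markov_value_def using lambda_at_special_upper by (intro SUP_least) simp
  also have "\<dots> < ereal 3.938776241989784910" by simp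
  finally have upper: "?m < ereal 3.938776241989784910" .
  \<comment> \<open>Used for both the interval from 3.938 to 3.939 and the gap from t to u.\<close>
  have between: "?m \<in> {ereal x<..<ereal y}"
    if "x < 3.938776241989784909" "3.938776241989784910 < y" for x y
  proof -
    have "ereal x < ereal 3.938776241989784909" "ereal 3.938776241989784910 < ereal y"
      using that by (simp_all only: less_ereal.simps)
    then show ?thesis using lower upper by (meson greaterThanLessThan_iff less_le_trans less_trans)
  qed
  have "?m \<notin> lagrange_spectrum"
  proof
    assume "?m \<in> lagrange_spectrum"
    then obtain a where a: "\<And>i. a i \<ge> 1" "?m = lagrange_value a"
      by (auto simp: lagrange_spectrum_def bi_seqs_def)
    then show False using lagrange_value_gap[of a] between[of "3938776241985 / 10 ^ 12" "3938776241990 / 10 ^ 12"]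
      by simp
  qed
  moreover have "?m \<in> markov_spectrum"
    using special_seq_pos by (auto simp: markov_spectrum_def bi_seqs_def)
  moreover have "?m \<in> {ereal 3.938<..<ereal 3.939}" by (rule between) simp_all
  ultimately show ?thesis using lower upper by blast
qed

end
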